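(* For all integers $d\ge 1$ and $n\ge 0$ the map $\mathrm{po}:\mathrm{dA}_n\to \mathrm{Av}_n(P_{d+3})$ is an injection.
   Context: $d$-ascent sequences. For a sequence $\alpha=a_1a_2\ldots a_n$ of nonnegative integers and $d\ge 0$, an index $k\in\{1,\dots,n-1\}$ is a $d$-ascent of $\alpha$ if $a_{k+1}>a_k-d$; $\mathrm{dasc}\,\alpha$ is the number of $d$-ascents of $\alpha$. Write $\alpha_k=a_1\ldots a_k$. The sequence $\alpha$ is a $d$-ascent sequence if $a_1=0$ and $a_{k+1}\le 1+\mathrm{dasc}\,\alpha_k$ for $k\in\{1,\dots,n-1\}$. $\mathrm{dA}_n$ is the set of $d$-ascent sequences of length $n$ (for $n=0$, just the empty sequence). Factorial posets. A poset $P$ on $[n]=\{1,\dots,n\}$ with strict order $<_P$ is factorial if for all $i,j,k\in[n]$: $i<j$ (as integers) and $j<_Pk$ imply $i<_Pk$. Special posets. A special $P_{d+3}$ in a poset $P$ on $[n]$ is an induced subposet consisting of a chain $i_1<_Pi_2<_P\dots<_Pi_{d+2}$ with $i_1<i_2<\dots<i_{d+2}$ as integers, together with the element $i_{d+1}+1$, where $i_{d+1}+1<i_{d+2}$ and $i_{d+1}+1$ is incomparable in $P$ to every element of the chain. $\mathrm{Av}_n(P_{d+3})$ is the set of factorial posets on $[n]$ that contain no special $P_{d+3}$. The map $\mathrm{po}$. For $\alpha=a_1\ldots a_n\in \mathrm{dA}_n$, $P=\mathrm{po}(\alpha)$ is the poset on $[n]$ in which, for distinct $i,j\in[n]$, $i<_Pj$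 if and only if $\mathrm{dasc}\,\alpha_i<a_j$. *)

theory Defs
  imports Main "HOL-Library.FuncSet"
begin

text \<open>
  A sequence \<open>a\<^sub>1 \<dots> a\<^sub>n\<close> is a \<open>nat list\<close> of length \<open>n\<close>. Indices are one-based, so the prefix
  \<open>a\<^sub>1 \<dots> a\<^sub>k\<close> is \<open>take k \<alpha>\<close>.
\<close>

definition entry :: "nat list \<Rightarrow> nat \<Rightarrow> nat" where
  "entry \<alpha> k = \<alpha> ! (k - 1)"

text \<open>
  The condition \<open>a\<^sub>k\<^sub>+\<^sub>1 > a\<^sub>k - d\<close> is an inequality of integers (\<open>a\<^sub>k - d\<close> may be negative); writing it
  with addition avoids truncated subtraction on \<open>nat\<close>.
\<close>

definition is_d_ascent :: "nat \<Rightarrow> nat list \<Rightarrow> nat \<Rightarrow> bool" where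
  "is_d_ascent d \<alpha> k \<longleftrightarrow> k \<in> {1..<length \<alpha>} \<and> entry \<alpha> k < entry \<alpha> (k + 1) + d"

definition dasc :: "nat \<Rightarrow> nat list \<Rightarrow> nat" where
  "dasc d \<alpha> = card {k. is_d_ascent d \<alpha> k}"

definition d_ascent_seq :: "nat \<Rightarrow> nat list \<Rightarrow> bool" where
  "d_ascent_seq d \<alpha> \<longleftrightarrow>
     (\<alpha> \<noteq> [] \<longrightarrow> entry \<alpha> 1 = 0) \<and>
     (\<forall>k\<in>{1..<length \<alpha>}. entry \<alpha> (k + 1) \<le> 1 + dasc d (take k \<alpha>))"

definition dA :: "nat \<Rightarrow> nat \<Rightarrow> nat list set" where
  "dA d n = {\<alpha>. length \<alpha> = n \<and> d_ascent_seq d \<alpha>}"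

text \<open>
  A poset on \<open>{1..n}\<close> is represented by its strict order relation, so \<open>(i, j) \<in> P\<close> means
  \<open>i <\<^sub>P j\<close>; plain \<open><\<close> is the order of the integers.
\<close>

definition poset_on :: "nat \<Rightarrow> nat rel \<Rightarrow> bool" where
  "poset_on n P \<longleftrightarrow> P \<subseteq> {1..n} \<times> {1..n} \<and> irrefl P \<and> trans P"

definition factorial_poset :: "nat \<Rightarrow> nat rel \<Rightarrow> bool" where
  "factorial_poset n P \<longleftrightarrow> poset_on n P \<and>
     (\<forall>i\<in>{1..n}. \<forall>j\<in>{1..n}. \<forall>k\<in>{1..n}. i < j \<and> (j, k) \<in> P \<longrightarrow> (i, k) \<in> P)"

definition incomparable :: "nat rel \<Rightarrow> nat \<Rightarrow> nat \<Rightarrow> bool" where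
  "incomparable P x y \<longleftrightarrow> x \<noteq> y \<and> (x, y) \<notin> P \<and> (y, x) \<notin> P"

text \<open>
  \<open>c 1, \<dots>, c (d + 2)\<close> is the chain of a special \<open>P\<^sub>d\<^sub>+\<^sub>3\<close>; the remaining element is
  \<open>c (d + 1) + 1\<close>.
\<close>

definition special_at :: "nat \<Rightarrow> nat \<Rightarrow> nat rel \<Rightarrow> (nat \<Rightarrow> nat) \<Rightarrow> bool" where
  "special_at d n P c \<longleftrightarrow>
     (\<forall>k\<in>{1..d + 2}. c k \<in> {1..n}) \<and>
     (\<forall>k\<in>{1..d + 1}. (c k, c (k + 1)) \<in> P \<and> c k < c (k + 1)) \<and>
     c (d + 1) + 1 < c (d + 2) \<and>
     (\<forall>k\<in>{1..d + 2}. incomparable P (c (d + 1) + 1) (c k))"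

definition Av :: "nat \<Rightarrow> nat \<Rightarrow> nat rel set" where
  "Av d n = {P. factorial_poset n P \<and> \<not> (\<exists>c. special_at d n P c)}"

definition po :: "nat \<Rightarrow> nat list \<Rightarrow> nat rel" where
  "po d \<alpha> = {(i, j). i \<in> {1..length \<alpha>} \<and> j \<in> {1..length \<alpha>} \<and> i \<noteq> j \<and>
                    dasc d (take i \<alpha>) < entry \<alpha> j}"

end

theory Submission
  imports Defs
begin

text \<open>
  Write \<open>D\<^sub>i\<close> for the number of \<open>d\<close>-ascents of the prefix \<open>a\<^sub>1 \<dots> a\<^sub>i\<close>. Everything rests on two facts.
  First, \<open>D\<^sub>1 = 0\<close> and each step from \<open>D\<^sub>i\<close> to \<open>D\<^sub>i\<^sub>+\<^sub>1\<close> adds \<open>0\<close> or \<open>1\<close>, so \<open>D\<close> is weakly increasing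
  and takes every value between \<open>0\<close> and \<open>D\<^sub>i\<close>. Second, a \<open>d\<close>-ascent sequence satisfies
  \<open>a\<^sub>i \<le> D\<^sub>i\<close> (lemma \<open>entry_le_dasc\<close>). Hence \<open>i <\<^sub>P j\<close>, that is \<open>D\<^sub>i < a\<^sub>j\<close>, forces \<open>i < j\<close>, and
  transitivity and the factorial property are read off from
  \<open>D\<^sub>i < a\<^sub>j \<le> D\<^sub>j < a\<^sub>k\<close> and from the monotonicity of \<open>D\<close>.

  Suppose that there were a special \<open>P\<^sub>d\<^sub>+\<^sub>3\<close> with chain \<open>c\<^sub>1, \<dots>, c\<^sub>d\<^sub>+\<^sub>2\<close>, and put \<open>m = c\<^sub>d\<^sub>+\<^sub>1\<close>
  and \<open>s = c\<^sub>1\<close>.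
  The element \<open>m\<close> is below \<open>c\<^sub>d\<^sub>+\<^sub>2\<close> but \<open>m + 1\<close> is not, so \<open>D\<close> grows at \<open>m\<close> and \<open>m\<close> is a
  \<open>d\<close>-ascent. On the other hand entries grow along the chain, so \<open>a\<^sub>m \<ge> D\<^sub>s + d\<close>
  (lemma \<open>chain_entry_ge\<close>; as \<open>d \<ge> 1\<close>, there is at least one step from \<open>s\<close> to \<open>m\<close>), while
  \<open>a\<^sub>m\<^sub>+\<^sub>1 \<le> D\<^sub>s\<close> because \<open>s\<close> is not below \<open>m + 1\<close>. So \<open>a\<^sub>m\<^sub>+\<^sub>1 \<le> a\<^sub>m - d\<close>, and \<open>m\<close> is not a
  \<open>d\<close>-ascent after all.

  For injectivity, the entries are recovered from the poset one at a time. Once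
  \<open>a\<^sub>1 \<dots> a\<^sub>j\<close> is known, so are \<open>D\<^sub>1, \<dots>, D\<^sub>j\<close>. Two candidates \<open>x < y \<le> D\<^sub>j + 1\<close> for the next entry
  are told apart by an index \<open>i \<le> j\<close> with \<open>D\<^sub>i = x\<close>: it lies below \<open>j + 1\<close> for the candidate \<open>y\<close>
  but not for \<open>x\<close>.
\<close>

lemma entry_take: "1 \<le> k \<Longrightarrow> k \<le> i \<Longrightarrow> entry (take i \<alpha>) k = entry \<alpha> k"
  by (simp add: entry_def)

lemma is_d_ascent_take:
  assumes "i \<le> length \<alpha>"
  shows "is_d_ascent d (take i \<alpha>) k \<longleftrightarrow> k < i \<and> is_d_ascent d \<alpha> k"
  using assms by (auto simp: is_d_ascent_def entry_take)

lemma dasc_take_1: "dasc d (take (Suc 0) \<alpha>) = 0"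
  by (simp add: dasc_def is_d_ascent_def)

lemma dasc_take_Suc:
  assumes "i < length \<alpha>"
  shows "dasc d (take (Suc i) \<alpha>) = dasc d (take i \<alpha>) + (if is_d_ascent d \<alpha> i then 1 else 0)"
proof -
  let ?A = "{k. k < i \<and> is_d_ascent d \<alpha> k}"
  have "{k. k < Suc i \<and> is_d_ascent d \<alpha> k} = (if is_d_ascent d \<alpha> i then insert i ?A else ?A)"
    by (auto simp: less_Suc_eq)
  then show ?thesis
    using assms by (simp add: dasc_def is_d_ascent_take)
qed

lemma dasc_take_mono:
  assumes "i \<le> j" "j \<le> length \<alpha>"
  shows "dasc d (take i \<alpha>) \<le> dasc d (take j \<alpha>)"
  using assms
proof (induction j rule: dec_induct)
  case (step j)
  then show ?case by (simp add: dasc_take_Suc)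
qed simp

text \<open>
  A discrete intermediate value property: \<open>D\<close> starts at \<open>0\<close> and never jumps by more than one.
\<close>

lemma dasc_take_attains:
  assumes "1 \<le> j" "j \<le> length \<alpha>" "v \<le> dasc d (take j \<alpha>)"
  shows "\<exists>i\<in>{1..j}. dasc d (take i \<alpha>) = v"
  using assms
proof (induction j rule: dec_induct)
  case base
  then show ?case by (simp add: dasc_take_1)
next
  case (step j)
  show ?case
  proof (cases "v \<le> dasc d (take j \<alpha>)")
    case True
    with step have "\<exists>i\<in>{1..j}. dasc d (take i \<alpha>) = v" by simp
    then show ?thesis by fastforce
  next
    case False
    with step.prems have "dasc d (take (Suc j) \<alpha>) = v"
      by (simp add: dasc_take_Suc split: if_splits)
    then show ?thesis by auto
  qed
qed

lemma d_ascent_seq_entry_1: "d_ascent_seq d \<alpha> \<Longrightarrow> \<alpha> \<noteq> [] \<Longrightarrow> entry \<alpha> (Suc 0) = 0"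
  by (simp add: d_ascent_seq_def)

lemma d_ascent_seq_entry_Suc:
  "d_ascent_seq d \<alpha> \<Longrightarrow> 1 \<le> k \<Longrightarrow> k < length \<alpha> \<Longrightarrow> entry \<alpha> (Suc k) \<le> Suc (dasc d (take k \<alpha>))"
  by (simp add: d_ascent_seq_def)

text \<open>
  If \<open>j\<close> is a \<open>d\<close>-ascent, the bound \<open>a\<^sub>j\<^sub>+\<^sub>1 \<le> 1 + D\<^sub>j\<close> is exactly \<open>a\<^sub>j\<^sub>+\<^sub>1 \<le> D\<^sub>j\<^sub>+\<^sub>1\<close>. Otherwise
  the sequence drops, \<open>a\<^sub>j\<^sub>+\<^sub>1 \<le> a\<^sub>j - d\<close>, and the bound is inherited from \<open>j\<close>.
\<close>

lemma entry_le_dasc: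
  assumes "d_ascent_seq d \<alpha>" "1 \<le> j" "j \<le> length \<alpha>"
  shows "entry \<alpha> j \<le> dasc d (take j \<alpha>)"
  using assms(2,3)
proof (induction j rule: dec_induct)
  case base
  then have "\<alpha> \<noteq> []" by auto
  then show ?case using d_ascent_seq_entry_1[OF assms(1)] by simp
next
  case (step j)
  then have D: "dasc d (take (Suc j) \<alpha>) = dasc d (take j \<alpha>) + (if is_d_ascent d \<alpha> j then 1 else 0)"
    and IH: "entry \<alpha> j \<le> dasc d (take j \<alpha>)"
    by (simp_all add: dasc_take_Suc)
  show ?case
  proof (cases "is_d_ascent d \<alpha> j")
    case True
    then show ?thesis using D d_ascent_seq_entry_Suc[OF assms(1), of j] step by simp
  next
    case False
    with step have "entry \<alpha> (Suc j) + d \<le> entry \<alpha> j"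
      by (auto simp: is_d_ascent_def)
    then show ?thesis using D IH by simp
  qed
qed

lemma po_iff:
  "(i, j) \<in> po d \<alpha> \<longleftrightarrow> i \<in> {1..length \<alpha>} \<and> j \<in> {1..length \<alpha>} \<and> i \<noteq> j \<and>
     dasc d (take i \<alpha>) < entry \<alpha> j"
  by (simp add: po_def)

lemma po_imp_less:
  assumes "d_ascent_seq d \<alpha>" "(i, j) \<in> po d \<alpha>"
  shows "i < j"
proof (rule ccontr)
  assume "\<not> i < j"
  then have "dasc d (take j \<alpha>) \<le> dasc d (take i \<alpha>)"
    using assms(2) by (intro dasc_take_mono) (auto simp: po_iff)
  then show False
    using entry_le_dasc[OF assms(1), of j] assms(2) by (auto simp: po_iff)
qed

lemma factorial_poset_po:
  assumes "d_ascent_seq d \<alpha>"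
  shows "factorial_poset (length \<alpha>) (po d \<alpha>)"
proof -
  have fact: "(i, k) \<in> po d \<alpha>" if "1 \<le> i" "i < j" "(j, k) \<in> po d \<alpha>" for i j k
  proof -
    have "dasc d (take i \<alpha>) \<le> dasc d (take j \<alpha>)"
      using that by (intro dasc_take_mono) (auto simp: po_iff)
    then show ?thesis
      using that po_imp_less[OF assms that(3)] by (auto simp: po_iff)
  qed
  \<comment> \<open>Since \<open>i <\<^sub>P j\<close> implies \<open>i < j\<close>, transitivity is an instance of the factorial property.\<close>
  have "trans (po d \<alpha>)"
    using fact po_imp_less[OF assms] by (meson atLeastAtMost_iff po_iff transI)
  moreover have "po d \<alpha> \<subseteq> {1..length \<alpha>} \<times> {1..length \<alpha>}" "irrefl (po d \<alpha>)"
    by (auto simp: po_iff irrefl_def)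
  ultimately show ?thesis
    using fact by (auto simp: factorial_poset_def poset_on_def)
qed

text \<open>
  With \<open>p = c\<^sub>k\<close> and \<open>q = c\<^sub>k\<^sub>+\<^sub>1\<close>, each step of the chain raises the entry, since
  \<open>a\<^sub>p \<le> D\<^sub>p < a\<^sub>q\<close>; the first step even starts from \<open>D\<close> at \<open>c\<^sub>1\<close>.
\<close>

lemma chain_entry_ge:
  assumes "d_ascent_seq d \<alpha>" "1 \<le> r" "\<forall>k\<in>{1..r}. (c k, c (k + 1)) \<in> po d \<alpha>"
  shows "dasc d (take (c 1) \<alpha>) + r \<le> entry \<alpha> (c (r + 1))"
  using assms(2,3)
proof (induction r rule: dec_induct)
  case base
  then show ?case by (simp add: po_iff numeral_2_eq_2)
next
  case (step r)
  have "(c (Suc r), c (Suc r + 1)) \<in> po d \<alpha>"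
    using step.prems by (rule bspec) simp
  then have "dasc d (take (c (Suc r)) \<alpha>) < entry \<alpha> (c (Suc r + 1))"
    "entry \<alpha> (c (Suc r)) \<le> dasc d (take (c (Suc r)) \<alpha>)"
    using entry_le_dasc[OF assms(1)] by (auto simp: po_iff)
  then show ?case using step by simp
qed

lemma po_avoids_special:
  assumes "d_ascent_seq d \<alpha>" "d \<ge> 1"
  shows "\<not> special_at d (length \<alpha>) (po d \<alpha>) c"
proof
  assume sp: "special_at d (length \<alpha>) (po d \<alpha>) c"
  define m where "m = c (d + 1)"
  define t where "t = c (d + 2)"
  have rng: "c k \<in> {1..length \<alpha>}" and inc: "incomparable (po d \<alpha>) (m + 1) (c k)"
    if "k \<in> {1..d + 2}" for k
    using sp that by (simp_all add: special_at_def m_def)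
  have chain: "\<forall>k\<in>{1..d + 1}. (c k, c (k + 1)) \<in> po d \<alpha>" and "m + 1 < t"
    using sp by (simp_all add: special_at_def m_def t_def)
  have m: "m \<in> {1..length \<alpha>}" and t: "t \<in> {1..length \<alpha>}" and c1: "c 1 \<in> {1..length \<alpha>}"
    unfolding m_def t_def by (rule rng, simp)+
  have inc_t: "incomparable (po d \<alpha>) (m + 1) t" and inc_1: "incomparable (po d \<alpha>) (m + 1) (c 1)"
    unfolding t_def by (rule inc, simp)+
  \<comment> \<open>Passing from \<open>m\<close> to \<open>m + 1\<close> loses the relation to \<open>t\<close>, so \<open>D\<close> must increase there.\<close>
  have "(m, t) \<in> po d \<alpha>"
    using bspec[OF chain, of "d + 1"] by (simp add: m_def t_def)
  then have "dasc d (take m \<alpha>) < entry \<alpha> t"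
    by (simp add: po_iff)
  also have "entry \<alpha> t \<le> dasc d (take (Suc m) \<alpha>)"
    using inc_t m t \<open>m + 1 < t\<close> by (auto simp: incomparable_def po_iff)
  finally have "is_d_ascent d \<alpha> m"
    using m t \<open>m + 1 < t\<close> by (simp add: dasc_take_Suc split: if_splits)
  then have asc: "entry \<alpha> m < entry \<alpha> (m + 1) + d"
    by (simp add: is_d_ascent_def)
  have "dasc d (take (c 1) \<alpha>) + d \<le> entry \<alpha> m"
    unfolding m_def using assms chain by (intro chain_entry_ge) auto
  moreover have "entry \<alpha> (m + 1) \<le> dasc d (take (c 1) \<alpha>)"
    using inc_1 m t c1 \<open>m + 1 < t\<close> by (auto simp: incomparable_def po_iff)
  ultimately show False using asc by simp
qed

text \<open>
  An asymmetric form of the step that recovers an entry from the poset. It suffices for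
  injectivity, since the roles of the two sequences can be exchanged.
\<close>

lemma next_entry_le:
  assumes \<beta>: "d_ascent_seq d \<beta>" and len: "length \<alpha> = length \<beta>" and po: "po d \<alpha> = po d \<beta>"
    and j: "1 \<le> j" "j < length \<beta>" and prefix: "take j \<alpha> = take j \<beta>"
  shows "entry \<beta> (Suc j) \<le> entry \<alpha> (Suc j)"
proof (rule ccontr)
  assume "\<not> ?thesis"
  then have less: "entry \<alpha> (Suc j) < entry \<beta> (Suc j)" by simp
  then have "entry \<alpha> (Suc j) \<le> dasc d (take j \<beta>)"
    using d_ascent_seq_entry_Suc[OF \<beta> j] by simp
  then obtain i where i: "i \<in> {1..j}" "dasc d (take i \<beta>) = entry \<alpha> (Suc j)"
    using dasc_take_attains[OF j(1), of \<beta>] j(2) by (metis less_imp_le)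
  have "take i \<alpha> = take i \<beta>"
    using prefix i(1) by (metis atLeastAtMost_iff min.absorb1 take_take)
  then have "(i, Suc j) \<notin> po d \<alpha>"
    using i(2) by (simp add: po_iff)
  moreover have "(i, Suc j) \<in> po d \<beta>"
    using i j less by (simp add: po_iff)
  ultimately show False using po by simp
qed

lemma po_inj:
  assumes \<alpha>: "d_ascent_seq d \<alpha>" and \<beta>: "d_ascent_seq d \<beta>"
    and len: "length \<alpha> = length \<beta>" and po: "po d \<alpha> = po d \<beta>"
  shows "\<alpha> = \<beta>"
proof -
  have "take j \<alpha> = take j \<beta>" if "j \<le> length \<beta>" for j
    using that
  proof (induction j)
    case (Suc j)
    then have prefix: "take j \<alpha> = take j \<beta>" by simp
    have "entry \<alpha> (Suc j) = entry \<beta> (Suc j)"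
    proof (cases "j = 0")
      case True
      then have "\<alpha> \<noteq> []" "\<beta> \<noteq> []" using Suc.prems len by auto
      then show ?thesis
        using True d_ascent_seq_entry_1[OF \<alpha>] d_ascent_seq_entry_1[OF \<beta>] by simp
    next
      case False
      then show ?thesis
        using next_entry_le[OF \<beta> len po] next_entry_le[OF \<alpha> len[symmetric] po[symmetric]]
          Suc.prems len prefix by (simp add: order_antisym)
    qed
    then show ?case
      using prefix Suc.prems len by (simp add: entry_def take_Suc_conv_app_nth)
  qed simp
  from this[of "length \<beta>"] show ?thesis using len by simp
qed

theorem theorem5p4:
  fixes d n :: nat
  assumes "d \<ge> 1"
  shows "po d \<in> dA d n \<rightarrow> Av d n \<and> inj_on (po d) (dA d n)"
proof
  show "po d \<in> dA d n \<rightarrow> Av d n"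
    using factorial_poset_po po_avoids_special assms by (auto simp: dA_def Av_def)
  show "inj_on (po d) (dA d n)"
    by (rule inj_onI) (auto simp: dA_def intro: po_inj)
qed

end
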